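(* Let $G$ be a graph, $v$ a node, and let $\pi_1,\pi_2,\dots$ be independent random paths, each obtained by choosing two nodes $s,t$ uniformly at random and then a shortest $s$–$t$ path uniformly at random; let $X_i=1$ if $v$ is an internal node of $\pi_i$ and $X_i=0$ otherwise, so that $\mathbb E[X_i]=b(v)$. Let $\omega>0$ be fixed and let $\tau$ be a positive integer-valued random variable with $\tau\le\omega$ such that the event $\{\tau=t\}$ is determined by $\pi_1,\dots,\pi_t$, and set $\tilde b(v)=\frac1\tau\sum_{i=1}^\tau X_i$. Then for all fixed real numbers $\delta_L,\delta_U\in(0,1)$, $\Pr\big(b(v)\le \tilde b(v)-f(\tilde b(v),\delta_L,\omega,\tau)\big)\le\delta_L$ and $\Pr\big(b(v)\ge\tilde b(v)+g(\tilde b(v),\delta_U,\omega,\tau)\big)\le\delta_U$, where $f(\tilde b,\delta_L,\omega,\tau)=\frac{1}{\tau}\log\frac{1}{\delta_L}\Big(\frac13-\frac{\omega}{\tau}+\sqrt{(\frac13-\frac{\omega}{\tau})^2+\frac{2\tilde b\omega}{\log(1/\delta_L)}}\Big)$ and $g(\tilde b,\delta_U,\omega,\tau)=\frac{1}{\tau}\log\frac{1}{\delta_U}\Big(\frac13+\frac{\omega}{\tau}+\sqrt{(\frac13+\frac{\omega}{\tau})^2+\frac{2\tilde b\omega}{\log(1/\delta_U)}}\Big)$.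
   Context: The normalized betweenness centrality of $v$ in a graph with $n$ nodes is $b(v)=\frac{1}{n(n-1)}\sum_{s\ne v\ne t}\frac{\sigma_{st}(v)}{\sigma_{st}}$, where $\sigma_{st}$ is the number of shortest $s$–$t$ paths and $\sigma_{st}(v)$ the number of those passing through $v$.
   Formalization: The first inequality is stated only for b(v) > 0: if b(v) = 0 then the estimate and f are both 0 almost surely, so the event has probability 1 > δ_L. The graph has at least two nodes, and s, t are a uniform ordered pair of distinct nodes. *)

theory Defs
  imports "HOL-Probability.Probability" "Graph_Theory.Kuratowski"
begin

text \<open>
  Directed and undirected unweighted graphs are treated uniformly: undirected graphs are the
  symmetric digraphs (locale \<^locale>\<open>graph\<close>). Paths are arc lists; as there are no parallel arcs
  in a \<^locale>\<open>digraph\<close>, they correspond to node sequences.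
\<close>

definition shortest_paths :: "('a, 'b) pre_digraph \<Rightarrow> 'a \<Rightarrow> 'a \<Rightarrow> 'b awalk set" where
  "shortest_paths G s t =
     {p. pre_digraph.apath G s p t \<and> (\<forall>q. pre_digraph.apath G s q t \<longrightarrow> length p \<le> length q)}"

definition num_shortest :: "('a, 'b) pre_digraph \<Rightarrow> 'a \<Rightarrow> 'a \<Rightarrow> nat" where
  "num_shortest G s t = card (shortest_paths G s t)"

definition num_shortest_through :: "('a, 'b) pre_digraph \<Rightarrow> 'a \<Rightarrow> 'a \<Rightarrow> 'a \<Rightarrow> nat" where
  "num_shortest_through G s t v =
     card {p \<in> shortest_paths G s t. v \<in> set (pre_digraph.awalk_verts G s p)}"

text \<open>
  Pairs without a connecting path contribute \<open>0 / 0 = 0\<close>; so does the diagonal \<open>s = t\<close>, where the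
  only shortest path is the empty one, which misses \<open>v\<close>.
\<close>

definition betweenness :: "('a, 'b) pre_digraph \<Rightarrow> 'a \<Rightarrow> real" where
  "betweenness G v =
     1 / (real (card (verts G)) * (real (card (verts G)) - 1)) *
     (\<Sum>s \<in> verts G - {v}. \<Sum>t \<in> verts G - {v}.
        real (num_shortest_through G s t v) / real (num_shortest G s t))"

text \<open>
  The two nodes are an ordered pair of distinct nodes, in accordance with the normalisation
  \<open>n (n - 1)\<close>. If there is no path from \<open>s\<close> to \<open>t\<close>, the sample is the empty arc list, which has no
  internal node and is not a path between distinct nodes.
\<close>

definition random_path :: "('a, 'b) pre_digraph \<Rightarrow> 'b awalk pmf" where
  "random_path G =
     bind_pmf (pmf_of_set {(s, t). s \<in> verts G \<and> t \<in> verts G \<and> s \<noteq> t})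
       (\<lambda>(s, t). if shortest_paths G s t = {} then return_pmf []
                 else pmf_of_set (shortest_paths G s t))"

definition hit :: "('a, 'b) pre_digraph \<Rightarrow> 'a \<Rightarrow> 'b awalk \<Rightarrow> real" where
  "hit G v p = (if v \<in> set (pre_digraph.inner_verts G p) then 1 else 0)"

definition empirical_betweenness ::
  "('a, 'b) pre_digraph \<Rightarrow> 'a \<Rightarrow> (nat \<Rightarrow> 'b awalk) \<Rightarrow> nat \<Rightarrow> real" where
  "empirical_betweenness G v ps k = 1 / real k * (\<Sum>i = 1..k. hit G v (ps i))"

definition lower_dev :: "real \<Rightarrow> real \<Rightarrow> real \<Rightarrow> nat \<Rightarrow> real" where
  "lower_dev b \<delta> \<omega> k =
     1 / real k * ln (1 / \<delta>) *
     (1 / 3 - \<omega> / real k + sqrt ((1 / 3 - \<omega> / real k)\<^sup>2 + 2 * b * \<omega> / ln (1 / \<delta>)))"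

definition upper_dev :: "real \<Rightarrow> real \<Rightarrow> real \<Rightarrow> nat \<Rightarrow> real" where
  "upper_dev b \<delta> \<omega> k =
     1 / real k * ln (1 / \<delta>) *
     (1 / 3 + \<omega> / real k + sqrt ((1 / 3 + \<omega> / real k)\<^sup>2 + 2 * b * \<omega> / ln (1 / \<delta>)))"

text \<open>
  The lower deviation vanishes at a zero estimate. Hence, for a node of betweenness \<open>0\<close>, the event
  \<open>b \<le> b' - f\<close> (with \<open>b'\<close> the estimate) reads \<open>0 \<le> 0\<close> and has probability \<open>1\<close>; the lower tail
  bound with a non-strict inequality therefore requires positive betweenness.
\<close>

lemma lower_dev_zero:
  assumes "0 < k" "real k \<le> \<omega>"
  shows "lower_dev 0 \<delta> \<omega> k = 0"
proof -
  have "1 \<le> \<omega> / real k" using assms by (simp add: field_simps)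
  then have "sqrt ((1 / 3 - \<omega> / real k)\<^sup>2) = - (1 / 3 - \<omega> / real k)" by simp
  then show ?thesis unfolding lower_dev_def by simp
qed

lemma (in fin_digraph) finite_shortest_paths: "finite (shortest_paths G s t)"
  by (rule finite_subset[OF _ apaths_finite[of s t]]) (auto simp: shortest_paths_def)

lemma (in wf_digraph) apath_inner_verts_iff:
  assumes "apath s p t" "s \<noteq> t"
  shows "v \<in> set (inner_verts p) \<longleftrightarrow> v \<in> set (awalk_verts s p) \<and> v \<noteq> s \<and> v \<noteq> t"
proof -
  have *: "awalk_verts u q = map (tail G) q @ [w]" if "cas u q w" for u q w
    using that by (induction q arbitrary: u) auto
  have c: "cas s p t" and d: "distinct (awalk_verts s p)"
    using assms(1) by (auto simp: apath_def awalk_def)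
  obtain e es where p: "p = e # es" using c assms(2) by (cases p) auto
  show ?thesis using *[OF c] d c by (fastforce simp: p inner_verts_def)
qed

lemma (in digraph) expectation_hit:
  assumes n: "2 \<le> card (verts G)"
  shows "measure_pmf.expectation (random_path G) (hit G v) = betweenness G v"
proof -
  let ?n = "real (card (verts G))"
  let ?P = "{(s, t). s \<in> verts G \<and> t \<in> verts G \<and> s \<noteq> t}"
  let ?r = "\<lambda>s t. real (num_shortest_through G s t v) / real (num_shortest G s t)"
  let ?k = "\<lambda>(s, t). if shortest_paths G s t = {} then return_pmf []
                 else pmf_of_set (shortest_paths G s t)"
  have P: "?P = (verts G \<times> verts G) - (\<lambda>s. (s, s)) ` verts G" by auto
  have fP: "finite ?P" unfolding P by simp
  have "card ?P = card (verts G) * card (verts G) - card (verts G)"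
    unfolding P by (subst card_Diff_subset) (auto simp: card_image inj_on_def card_cartesian_product)
  then have cP: "real (card ?P) = ?n * (?n - 1)"
    by (simp add: of_nat_diff algebra_simps)
  have "real (card ?P) > 0" unfolding cP using n by simp
  then have neP: "?P \<noteq> {}" by (metis card.empty of_nat_0 less_irrefl)
  have inner: "measure_pmf.expectation (?k (s, t)) (hit G v) = (if s \<noteq> v \<and> t \<noteq> v then ?r s t else 0)"
    if "(s, t) \<in> ?P" for s t
  proof (cases "shortest_paths G s t = {}")
    case True
    then show ?thesis by (simp add: hit_def num_shortest_def num_shortest_through_def)
  next
    case False
    have h: "hit G v p = (if s \<noteq> v \<and> t \<noteq> v \<and> v \<in> set (awalk_verts s p) then 1 else 0)"
      if "p \<in> shortest_paths G s t" for p
      using apath_inner_verts_iff[of s p t v] that \<open>(s, t) \<in> ?P\<close>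
      by (auto simp: hit_def shortest_paths_def)
    have "measure_pmf.expectation (?k (s, t)) (hit G v)
        = (\<Sum>p\<in>shortest_paths G s t. hit G v p) / real (card (shortest_paths G s t))"
      using False by (simp add: integral_pmf_of_set finite_shortest_paths)
    also have "(\<Sum>p\<in>shortest_paths G s t. hit G v p)
        = (\<Sum>p\<in>shortest_paths G s t. if s \<noteq> v \<and> t \<noteq> v \<and> v \<in> set (awalk_verts s p) then 1 else 0)"
      by (rule sum.cong) (simp_all only: h)
    also have "\<dots> = (if s \<noteq> v \<and> t \<noteq> v then real (num_shortest_through G s t v) else 0)"
      by (auto simp: num_shortest_through_def finite_shortest_paths simp flip: sum.inter_filter)
    finally show ?thesis by (simp add: num_shortest_def)
  qed
  have diag: "?r s s = 0" if "s \<noteq> v" for s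
  proof -
    have "p = []" if p: "p \<in> shortest_paths G s s" for p
    proof -
      have "apath s [] s" using p by (auto simp: shortest_paths_def apath_def awalk_def)
      then have "length p \<le> length ([] :: 'b list)" using p unfolding shortest_paths_def by blast
      then show ?thesis by simp
    qed
    then have "{p \<in> shortest_paths G s s. v \<in> set (awalk_verts s p)} = {}"
      using that by force
    then have "num_shortest_through G s s v = 0"
      unfolding num_shortest_through_def by (metis card.empty)
    then show ?thesis by simp
  qed
  have "measure_pmf.expectation (random_path G) (hit G v)
      = (\<Sum>x\<in>?P. measure_pmf.expectation (?k x) (hit G v)) / real (card ?P)"
    unfolding random_path_def
    by (subst pmf_expectation_bind_pmf_of_set[OF neP fP])
       (auto simp: finite_shortest_paths sum_divide_distrib divide_inverse sum_distrib_left mult.commute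
          split: if_splits)
  also have "(\<Sum>x\<in>?P. measure_pmf.expectation (?k x) (hit G v))
      = (\<Sum>(s, t)\<in>?P. if s \<noteq> v \<and> t \<noteq> v then ?r s t else 0)"
    using inner by (intro sum.cong) auto
  also have "\<dots> = (\<Sum>(s, t)\<in>(verts G - {v}) \<times> (verts G - {v}). ?r s t)"
    by (rule sum.mono_neutral_cong) (use diag fP in \<open>auto split: if_splits\<close>)
  also have "\<dots> = (\<Sum>s\<in>verts G - {v}. \<Sum>t\<in>verts G - {v}. ?r s t)"
    by (simp add: sum.cartesian_product)
  finally show ?thesis by (simp add: betweenness_def cP)
qed

end

theory Submission
  imports Defs
begin

text \<open>
  Put \<open>l = log (1 / \<delta>)\<close> and let \<open>d\<close> be the deviation of \<open>X\<^sub>1 + \<dots> + X\<^sub>\<tau>\<close> from \<open>\<tau> b\<close>, in either direction.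
  Solving the quadratic equations behind \<open>f\<close> and \<open>g\<close>, both events force
  \<open>d \<ge> 0\<close> and \<open>d\<^sup>2 \<ge> 2 l (\<omega> b + d / 3)\<close>, that is, \<open>d\<close> reaches a threshold that does not depend
  on \<open>\<tau>\<close>. For such a threshold the Bernstein--Freedman bound holds at the stopping time: the
  exponential supermartingale stopped at \<open>\<tau> \<le> \<omega>\<close> has expectation at most \<open>1\<close>, and Markov's inequality
  with the usual choice of the exponent gives exactly \<open>exp (- l) = \<delta>\<close>.
\<close>

section \<open>An exponential estimate by comparison with a geometric series\<close>

lemma two_mult_power3_le_fact: "2 * 3 ^ n \<le> (fact (n + 2) :: real)"
proof (induction n)
  case (Suc n)
  have "2 * 3 ^ Suc n \<le> 3 * (fact (n + 2) :: real)"
    using Suc unfolding power_Suc by linarith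
  also have "\<dots> \<le> (real n + 3) * fact (n + 2)" by (intro mult_right_mono) auto
  also have "\<dots> = fact (Suc n + 2)" by (simp add: algebra_simps)
  finally show ?case .
qed simp

text \<open>As (n+2)! is at least 2 * 3^n, the exponential series from its quadratic term on is
  dominated termwise by a geometric series of ratio |x|/3. This ratio is the source of the 1/3 in
  the Bernstein bound.\<close>

lemma exp_minus_linear_le:
  fixes x :: real
  assumes "\<bar>x\<bar> < 3"
  shows "exp x - 1 - x \<le> x\<^sup>2 / (2 * (1 - \<bar>x\<bar> / 3))"
proof -
  have geo: "(\<lambda>n. (x\<^sup>2 / 2) * (\<bar>x\<bar> / 3) ^ n) sums ((x\<^sup>2 / 2) * (1 / (1 - \<bar>x\<bar> / 3)))"
    using assms by (intro sums_mult geometric_sums) auto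
  have "exp x - 1 - x = (\<Sum>n. inverse (fact (n + 2)) *\<^sub>R (x ^ (n + 2)))"
    using exp_first_two_terms[of x] by simp
  also have "\<dots> \<le> (\<Sum>n. (x\<^sup>2 / 2) * (\<bar>x\<bar> / 3) ^ n)"
  proof (rule suminf_le)
    fix n
    have "inverse (fact (n + 2)) *\<^sub>R x ^ (n + 2) \<le> inverse (fact (n + 2)) * \<bar>x\<bar> ^ (n + 2)"
      unfolding real_scaleR_def by (intro mult_left_mono) (simp_all add: power_abs[symmetric] del: power_Suc fact_Suc)
    also have "\<dots> \<le> inverse (2 * 3 ^ n) * \<bar>x\<bar> ^ (n + 2)"
      by (intro mult_right_mono le_imp_inverse_le two_mult_power3_le_fact) auto
    also have "\<dots> = (x\<^sup>2 / 2) * (\<bar>x\<bar> / 3) ^ n"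
      by (simp add: field_simps power_add power2_eq_square)
    finally show "inverse (fact (n + 2)) *\<^sub>R x ^ (n + 2) \<le> (x\<^sup>2 / 2) * (\<bar>x\<bar> / 3) ^ n" .
  next
    show "summable (\<lambda>n. inverse (fact (n + 2)) *\<^sub>R x ^ (n + 2))"
      using summable_exp_generic[of x] by (subst summable_iff_shift)
  qed (use geo in \<open>auto simp: sums_iff\<close>)
  also have "\<dots> = x\<^sup>2 / (2 * (1 - \<bar>x\<bar> / 3))"
    using geo by (simp add: sums_iff)
  finally show ?thesis .
qed

section \<open>Inverting the quadratic equations behind the two deviations\<close>

lemma ge_add_sqrtD:
  fixes a c y :: real
  assumes "a + sqrt (a\<^sup>2 + c) \<le> y" "0 \<le> c"
  shows "0 \<le> y" and "2 * a * y + c \<le> y\<^sup>2"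
proof -
  have "\<bar>a\<bar> \<le> sqrt (a\<^sup>2 + c)" using assms(2) by (intro real_le_rsqrt) simp
  then show "0 \<le> y" using assms(1) by linarith
  have "sqrt (a\<^sup>2 + c) \<le> y - a" using assms(1) by simp
  then have "a\<^sup>2 + c \<le> (y - a)\<^sup>2" by (rule sqrt_le_D)
  then show "2 * a * y + c \<le> y\<^sup>2" by (simp add: power2_eq_square algebra_simps)
qed

text \<open>The sign e = 1 serves \<open>lower_dev\<close> and e = -1 serves
  \<open>upper_dev\<close>. The assumption says that y = d / l is at least the root a + sqrt (a^2 +
  c), where a = 1/3 - e \<omega> / k and c = 2 b \<omega> / l. Substituting b = p + e y l / k into c
  produces 2 e \<omega> y / k, which cancels the same term in 2 a y; this removes k.\<close>

lemma deviation_quadratic: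
  fixes k :: nat and e l \<omega> b p :: real
  assumes k: "0 < k" and l: "0 < l" and om: "0 \<le> \<omega>" and b: "0 \<le> b" and e: "e * e = 1"
    and p: "1 / real k * l * (1 / 3 - e * \<omega> / real k +
          sqrt ((1 / 3 - e * \<omega> / real k)\<^sup>2 + 2 * b * \<omega> / l)) \<le> e * (b - p)"
  defines "d \<equiv> e * (real k * b - real k * p)"
  shows "0 \<le> d" and "2 * l * (\<omega> * p + d / 3) \<le> d\<^sup>2"
proof -
  define y where "y = d / l"
  have d: "d = y * l" using l by (simp add: y_def)
  have "e * d = (e * e) * (real k * b - real k * p)" by (simp add: d_def)
  then have bp: "b = p + e * y * l / k" using k d e by (simp add: field_simps)
  have le: "1 / 3 - e * \<omega> / real k + sqrt ((1 / 3 - e * \<omega> / real k)\<^sup>2 + 2 * b * \<omega> / l) \<le> y"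
    using p k l by (simp add: y_def d_def field_simps)
  note D = ge_add_sqrtD[OF le]
  have c: "0 \<le> 2 * b * \<omega> / l" using b om l by simp
  show "0 \<le> d" using D(1)[OF c] d l by simp
  have "2 * (1 / 3 - e * \<omega> / real k) * y + 2 * b * \<omega> / l = 2 * y / 3 + 2 * p * \<omega> / l"
    unfolding bp using k l by (simp add: field_simps)
  then have "2 * y / 3 + 2 * p * \<omega> / l \<le> y\<^sup>2" using D(2)[OF c] by simp
  then have "(2 * y / 3 + 2 * p * \<omega> / l) * l\<^sup>2 \<le> y\<^sup>2 * l\<^sup>2" by (intro mult_right_mono) auto
  moreover have "(2 * y / 3 + 2 * p * \<omega> / l) * l\<^sup>2 = 2 * l * (\<omega> * p + d / 3)"
    unfolding d using l by (simp add: field_simps power2_eq_square)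
  moreover have "y\<^sup>2 * l\<^sup>2 = d\<^sup>2" by (simp add: d power_mult_distrib)
  ultimately show "2 * l * (\<omega> * p + d / 3) \<le> d\<^sup>2" by simp
qed

text \<open>Here r is the larger root of a quadratic whose other root is negative, so on nonnegative
  d the inequality means reaching r. The equation for r later makes the exponent exactly l.\<close>

lemma bernstein_threshold:
  fixes l V :: real
  assumes "0 < l" "0 < V"
  obtains r where "0 < r" "r\<^sup>2 = 2 * l * (V + r / 3)"
    "\<And>d. 0 \<le> d \<Longrightarrow> 2 * l * (V + d / 3) \<le> d\<^sup>2 \<Longrightarrow> r \<le> d"
proof
  let ?q = "sqrt ((l / 3)\<^sup>2 + 2 * l * V)"
  have s: "?q\<^sup>2 = (l / 3)\<^sup>2 + 2 * l * V" using assms by simp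
  show "0 < l / 3 + ?q" using assms by (intro add_pos_nonneg) auto
  show "(l / 3 + ?q)\<^sup>2 = 2 * l * (V + (l / 3 + ?q) / 3)" unfolding power2_sum s
    by (simp add: field_simps power2_eq_square)
  fix d :: real
  assume d: "0 \<le> d" "2 * l * (V + d / 3) \<le> d\<^sup>2"
  then have "(l / 3)\<^sup>2 + 2 * l * V \<le> (d - l / 3)\<^sup>2"
    by (simp add: field_simps power2_eq_square)
  then have "?q \<le> \<bar>d - l / 3\<bar>" using real_sqrt_le_mono by fastforce
  \<comment> \<open>Together with d >= 0 this excludes the branch d - l/3 <= - \<open>?q\<close> of
    the absolute value.\<close>
  moreover have "l / 3 < ?q" using assms by (intro real_less_rsqrt) simp
  ultimately show "l / 3 + ?q \<le> d" using d by linarith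
qed

section \<open>The stopped exponential supermartingale\<close>

text \<open>Induction on n: going from n to n+1 brings in one new factor, and only on the event n <
  \<tau>. That event is determined by the first n variables, hence independent of the new factor,
  whose mean is at most 1.\<close>

lemma (in prob_space) expectation_stopped_prod_le_1:
  fixes X :: "nat \<Rightarrow> 'a \<Rightarrow> 'c" and w :: "'c \<Rightarrow> real" and \<tau> :: "'a \<Rightarrow> nat"
  assumes indep: "indep_vars (\<lambda>_. count_space UNIV) X {1..}"
    and fin: "finite S" and supp: "\<And>i. 1 \<le> i \<Longrightarrow> AE x in M. X i x \<in> S"
    and w0: "\<And>c. 0 \<le> w c" and wB: "\<And>c. w c \<le> B"
    and w1: "\<And>i. 1 \<le> i \<Longrightarrow> expectation (\<lambda>x. w (X i x)) \<le> 1"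
    and \<tau>[measurable]: "\<tau> \<in> measurable M (count_space UNIV)"
    and adapted: "\<And>t. \<exists>D. \<forall>x\<in>space M. \<tau> x = t \<longleftrightarrow> map (\<lambda>i. X i x) [1..<Suc t] \<in> D"
  shows "integrable M (\<lambda>x. \<Prod>i=1..min n (\<tau> x). w (X i x))"
    and "expectation (\<lambda>x. \<Prod>i=1..min n (\<tau> x). w (X i x)) \<le> 1"
proof -
  have X: "X i \<in> measurable M (count_space UNIV)" if "1 \<le> i" for i
    using indep that by (auto simp: indep_vars_def)
  have wX: "(\<lambda>x. w (X i x)) \<in> borel_measurable M" if "1 \<le> i" for i
    using measurable_compose[OF X[OF that], of w borel] by simp
  have prod_meas: "(\<lambda>x. \<Prod>i=1..m. w (X i x)) \<in> borel_measurable M" for m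
    by (intro borel_measurable_prod wX) auto
  \<comment> \<open>B may be below 1; with the maximum, the n-th power also bounds products of fewer
    than n factors.\<close>
  have B1: "1 \<le> max 1 B" by simp
  have prod_bound: "(\<Prod>i=1..m. w (X i x)) \<le> max 1 B ^ n" if "m \<le> n" for m n x
  proof -
    have "(\<Prod>i=1..m. w (X i x)) \<le> (\<Prod>i=1..m. max 1 B)"
      by (intro prod_mono conjI w0) (use wB in \<open>simp add: le_max_iff_disj\<close>)
    also have "\<dots> \<le> max 1 B ^ n" using power_increasing[OF that B1] by simp
    finally show ?thesis .
  qed
  let ?Y = "\<lambda>n x. \<Prod>i=1..min n (\<tau> x). w (X i x)"
  have Ymeas[measurable]: "?Y n \<in> borel_measurable M" for n
    by (rule measurable_compose_countable[where g=\<tau> and f="\<lambda>t x. \<Prod>i=1..min n t. w (X i x)"])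
       (use prod_meas \<tau> in auto)
  have Y0: "0 \<le> ?Y n x" for n x by (intro prod_nonneg w0)
  show Yint: "integrable M (?Y n)" for n
    by (rule integrable_const_bound[where B="max 1 B ^ n"])
       (use prod_bound[of "min n _" n] Y0 Ymeas[of n] in auto)
  show "expectation (?Y n) \<le> 1"
  proof (induction n)
    case 0
    then show ?case by (simp add: prob_space)
  next
    case (Suc n)
    obtain D where D: "\<And>t x. x \<in> space M \<Longrightarrow> \<tau> x = t \<longleftrightarrow> map (\<lambda>i. X i x) [1..<Suc t] \<in> D t"
      using adapted by metis
    \<comment> \<open>The sets \<open>D t\<close> need not be measurable in the product \<open>\<sigma>\<close>-algebra. Cutting down to the finite
      support \<open>S\<close> makes the event \<open>n < \<tau>\<close> a measurable function of \<open>X\<^sub>1, \<dots>, X\<^sub>n\<close> up to a null set.\<close>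
    define A where "A = {f \<in> PiE {1..n} (\<lambda>_. S). \<forall>t\<le>n. map f [1..<Suc t] \<notin> D t}"
    \<comment> \<open>Almost surely \<open>h (F x)\<close> is the running product on n < \<tau> and
      0 elsewhere. Being a function of the first n variables, it is independent of the next
      one.\<close>
    define h where "h f = indicator A f * (\<Prod>i=1..n. w (f i))" for f
    define F where "F x = restrict (\<lambda>i. X i x) {1..n}" for x
    let ?P = "PiM {1..n} (\<lambda>_. count_space UNIV :: 'c measure)"
    \<comment> \<open>Measurability of \<open>A\<close>: it is a finite union of singletons, each a
      box over finitely many discrete coordinates.\<close>
    have "finite A" unfolding A_def
      by (rule finite_subset[OF _ finite_PiE[of "{1..n}" "\<lambda>_. S"]]) (use fin in auto)
    moreover have "{f} \<in> sets ?P" if "f \<in> A" for f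
    proof -
      have "PiE {1..n} (\<lambda>i. {f i}) \<in> sets ?P" by (intro sets_PiM_I_finite) auto
      moreover have "PiE {1..n} (\<lambda>i. {f i}) = {f}"
        using that by (intro PiE_singleton) (auto simp: A_def PiE_def)
      ultimately show ?thesis by metis
    qed
    ultimately have "(\<Union>f\<in>A. {f}) \<in> sets ?P" by (intro sets.finite_UN) auto
    then have A[measurable]: "A \<in> sets ?P" by simp
    have "(\<lambda>f. w (f i)) \<in> borel_measurable ?P" if "i \<in> {1..n}" for i
      using that by (intro measurable_compose[OF measurable_component_singleton]) auto
    then have h: "h \<in> borel_measurable ?P" unfolding h_def by measurable
    have "indep_var borel (h \<circ> F) borel ((\<lambda>f. w (f (Suc n))) \<circ> (\<lambda>x. restrict (\<lambda>i. X i x) {Suc n}))"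
      unfolding F_def
      by (intro indep_var_compose[OF indep_var_restrict[OF indep]] h[unfolded h_def]
            measurable_compose[OF measurable_component_singleton]) (use h in auto)
    then have ind: "indep_var borel (\<lambda>x. h (F x)) borel (\<lambda>x. w (X (Suc n) x))"
      by (simp add: comp_def)
    have Fm: "F \<in> measurable M ?P" unfolding F_def by (intro measurable_restrict X) auto
    have hF_meas[measurable]: "(\<lambda>x. h (F x)) \<in> borel_measurable M"
      using measurable_compose[OF Fm h] .
    have hF: "h (F x) = indicator A (F x) * (\<Prod>i=1..n. w (X i x))" for x
      by (auto simp: h_def F_def)
    have hF0: "0 \<le> h (F x)" for x unfolding hF by (intro mult_nonneg_nonneg prod_nonneg w0) auto
    have hF_int: "integrable M (\<lambda>x. h (F x))"
      by (rule integrable_const_bound[where B="max 1 B ^ n"])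
         (use prod_bound[of n n] hF0 hF_meas in \<open>auto simp: hF indicator_def\<close>)
    have w_int: "integrable M (\<lambda>x. w (X (Suc n) x))"
      by (rule integrable_const_bound[where B=B]) (use wB w0 wX in auto)
    have AEA: "AE x in M. F x \<in> A \<longleftrightarrow> n < \<tau> x"
    proof -
      have "AE x in M. \<forall>i\<in>{1..n}. X i x \<in> S" by (intro AE_finite_allI supp) auto
      then show ?thesis
      proof (rule AE_mp, intro AE_I2 impI)
        fix x assume x: "x \<in> space M" and S: "\<forall>i\<in>{1..n}. X i x \<in> S"
        have "map (F x) [1..<Suc t] = map (\<lambda>i. X i x) [1..<Suc t]" if "t \<le> n" for t
          using that by (auto simp: F_def)
        then have "map (F x) [1..<Suc t] \<notin> D t \<longleftrightarrow> \<tau> x \<noteq> t" if "t \<le> n" for t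
          unfolding D[OF x] using that by metis
        moreover have "F x \<in> PiE {1..n} (\<lambda>_. S)" using S by (auto simp: F_def)
        ultimately have "F x \<in> A \<longleftrightarrow> (\<forall>t\<le>n. \<tau> x \<noteq> t)"
          unfolding A_def mem_Collect_eq by blast
        then show "F x \<in> A \<longleftrightarrow> n < \<tau> x" by (auto simp: not_le[symmetric])
      qed
    qed
    \<comment> \<open>On n < \<tau> the product \<open>?Y n x\<close> equals \<open>h (F x)\<close>
      and gains one factor; otherwise the product is already frozen and \<open>h (F x)\<close>
      vanishes.\<close>
    have step: "AE x in M. ?Y (Suc n) x = ?Y n x + (h (F x) * w (X (Suc n) x) - h (F x))"
      using AEA
    proof (rule AE_mp, intro AE_I2 impI)
      fix x assume "F x \<in> A \<longleftrightarrow> n < \<tau> x"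
      then show "?Y (Suc n) x = ?Y n x + (h (F x) * w (X (Suc n) x) - h (F x))"
        by (cases "n < \<tau> x") (simp_all add: hF min_def not_less)
    qed
    have hw_int: "integrable M (\<lambda>x. h (F x) * w (X (Suc n) x))"
      by (rule indep_var_integrable[OF ind hF_int w_int])
    have "expectation (?Y (Suc n)) = expectation (\<lambda>x. ?Y n x + (h (F x) * w (X (Suc n) x) - h (F x)))"
      using step
      by (intro integral_cong_AE borel_measurable_add borel_measurable_diff borel_measurable_times
            Ymeas hF_meas wX) auto
    also have "\<dots> = expectation (?Y n) + (expectation (\<lambda>x. h (F x)) * expectation (\<lambda>x. w (X (Suc n) x))
        - expectation (\<lambda>x. h (F x)))"
      using Yint[of n] hw_int hF_int
      by (simp add: indep_var_lebesgue_integral[OF ind hF_int w_int])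
    also have "\<dots> \<le> expectation (?Y n)"
      using mult_left_mono[OF w1[of "Suc n"], of "expectation (\<lambda>x. h (F x))"]
      by (simp add: integral_nonneg_AE hF0)
    finally show ?case using Suc by linarith
  qed
qed

section \<open>The Bernstein bound at the stopping time\<close>

lemma (in prob_space) stopped_bernstein:
  fixes X :: "nat \<Rightarrow> 'a \<Rightarrow> 'c" and u :: "'c \<Rightarrow> real" and \<tau> :: "'a \<Rightarrow> nat" and p \<omega> l e :: real
  assumes indep: "indep_vars (\<lambda>_. count_space UNIV) X {1..}"
    and fin: "finite S" and supp: "\<And>i. 1 \<le> i \<Longrightarrow> AE x in M. X i x \<in> S"
    and u: "\<And>c. u c \<in> {0, 1}"
    and mean: "\<And>i. 1 \<le> i \<Longrightarrow> expectation (\<lambda>x. u (X i x)) = p"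
    and \<tau>: "\<tau> \<in> measurable M (count_space UNIV)"
    and bound: "\<And>x. x \<in> space M \<Longrightarrow> real (\<tau> x) \<le> \<omega>"
    and adapted: "\<And>t. \<exists>D. \<forall>x\<in>space M. \<tau> x = t \<longleftrightarrow> map (\<lambda>i. X i x) [1..<Suc t] \<in> D"
    and p: "0 < p" and om: "0 < \<omega>" and l: "0 < l" and e: "\<bar>e\<bar> = 1"
  defines "d \<equiv> \<lambda>x. e * ((\<Sum>i=1..\<tau> x. u (X i x)) - real (\<tau> x) * p)"
  shows "prob {x \<in> space M. 0 \<le> d x \<and> 2 * l * (\<omega> * p + d x / 3) \<le> (d x)\<^sup>2} \<le> exp (- l)"
    (is "prob ?E \<le> _")
proof -
  define V where "V = \<omega> * p"
  have V: "0 < V" using p om by (simp add: V_def)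
  obtain r where r0: "0 < r" and r2: "r\<^sup>2 = 2 * l * (V + r / 3)"
    and r_le: "\<And>y. 0 \<le> y \<Longrightarrow> 2 * l * (V + y / 3) \<le> y\<^sup>2 \<Longrightarrow> r \<le> y"
    using bernstein_threshold[OF l V] by blast
  \<comment> \<open>With this exponent 1 - \<theta>/3 = V / (V + r/3), so the compensation V \<phi>
    costs at most half of \<theta> r. The equation for r gives \<theta> r = 2 l, which leaves
    l.\<close>
  define \<theta> where "\<theta> = r / (V + r / 3)"
  have \<theta>0: "0 < \<theta>" and \<theta>3: "\<theta> < 3" using r0 V by (auto simp: \<theta>_def field_simps)
  \<comment> \<open>The sign sits in the exponent, so one weight covers both tails; the exponential
    estimate sees only |c|.\<close>
  define c where "c = e * \<theta>"
  have absc: "\<bar>c\<bar> = \<theta>" using e \<theta>0 by (simp add: c_def abs_mult)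
  define \<phi> where "\<phi> = exp c - 1 - c"
  have \<phi>0: "0 \<le> \<phi>" using exp_ge_add_one_self[of c] unfolding \<phi>_def by linarith
  have "\<phi> \<le> c\<^sup>2 / (2 * (1 - \<bar>c\<bar> / 3))"
    unfolding \<phi>_def by (rule exp_minus_linear_le) (simp add: absc \<theta>3)
  then have "\<phi> \<le> \<theta>\<^sup>2 / (2 * (1 - \<theta> / 3))"
    using absc by (metis power2_abs)
  then have "V * \<phi> \<le> V * (\<theta>\<^sup>2 / (2 * (1 - \<theta> / 3)))" using V by (intro mult_left_mono) auto
  also have "\<dots> = \<theta> * r / 2"
  proof -
    have "1 - \<theta> / 3 = V / (V + r / 3)" using V r0 by (simp add: \<theta>_def field_simps)
    moreover have "V + r / 3 > 0" using V r0 by simp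
    ultimately show ?thesis using V by (simp add: \<theta>_def power2_eq_square)
  qed
  finally have V\<phi>: "V * \<phi> \<le> \<theta> * r / 2" .
  have \<theta>r: "\<theta> * r = 2 * l"
  proof -
    have "V + r / 3 > 0" using V r0 by simp
    then show ?thesis using r2 by (simp add: \<theta>_def power2_eq_square field_simps)
  qed
  \<comment> \<open>The term p \<phi> compensates the growth of the exponential moment; it uses p as
    a bound for the variance p (1 - p).\<close>
  define w where "w y = exp (c * (u y - p) - p * \<phi>)" for y
  \<comment> \<open>On {0, 1} the exponential is affine in u, so the mean of the weight depends on p
    alone.\<close>
  have w_eq: "w y = exp (- c * p - p * \<phi>) * (1 + u y * (exp c - 1))" for y
  proof -
    have "exp (c * u y) = 1 + u y * (exp c - 1)" using u[of y] by auto
    moreover have "w y = exp (- c * p - p * \<phi>) * exp (c * u y)"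
      by (simp add: w_def exp_add[symmetric] algebra_simps)
    ultimately show ?thesis by simp
  qed
  define B where "B = max (exp (c * (0 - p) - p * \<phi>)) (exp (c * (1 - p) - p * \<phi>))"
  have w_le: "w y \<le> B" for y using u[of y] unfolding w_def B_def by auto
  have w1: "expectation (\<lambda>x. w (X i x)) \<le> 1" if i: "1 \<le> i" for i
  proof -
    have X: "X i \<in> measurable M (count_space UNIV)"
      using indep i by (auto simp: indep_vars_def)
    have "(\<lambda>x. u (X i x)) \<in> borel_measurable M"
      using measurable_compose[OF X, of u borel] by simp
    moreover have "norm (u y) \<le> 1" for y using u[of y] by auto
    ultimately have int: "integrable M (\<lambda>x. u (X i x))"
      by (intro integrable_const_bound[where B=1] AE_I2)
    have "expectation (\<lambda>x. w (X i x)) = exp (- c * p - p * \<phi>) * (1 + p * (exp c - 1))"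
      unfolding w_eq using int by (simp add: mean[OF i] prob_space)
    also have "\<dots> \<le> exp (- c * p - p * \<phi>) * exp (p * (exp c - 1))"
      by (intro mult_left_mono exp_ge_add_one_self) auto
    also have "\<dots> = 1" by (simp add: exp_add[symmetric] \<phi>_def algebra_simps)
    finally show ?thesis .
  qed
  define n where "n = nat \<lfloor>\<omega>\<rfloor>"
  have \<tau>n: "min n (\<tau> x) = \<tau> x" if "x \<in> space M" for x
    using bound[OF that] by (simp add: n_def le_nat_floor min_absorb2)
  let ?Y = "\<lambda>x. \<Prod>i=1..min n (\<tau> x). w (X i x)"
  have w0: "0 \<le> w y" for y by (simp add: w_def)
  note Y = expectation_stopped_prod_le_1[OF indep fin supp w0 w_le w1 \<tau> adapted, of n]
  have "?E \<subseteq> {x \<in> space M. exp l \<le> ?Y x}"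
  proof safe
    fix x assume x: "x \<in> space M" and d0: "0 \<le> d x" and d2: "2 * l * (\<omega> * p + d x / 3) \<le> (d x)\<^sup>2"
    have "r \<le> d x" by (rule r_le[OF d0]) (use d2 in \<open>simp add: V_def\<close>)
    then have "2 * l \<le> \<theta> * d x" unfolding \<theta>r[symmetric] using \<theta>0 by (intro mult_left_mono) auto
    \<comment> \<open>As \<phi> >= 0, the random total compensation is at most its value at
      \<omega>, namely V \<phi>.\<close>
    moreover have "real (\<tau> x) * (p * \<phi>) \<le> \<omega> * (p * \<phi>)"
      using bound[OF x] p \<phi>0 by (intro mult_right_mono) auto
    ultimately have "l \<le> \<theta> * d x - real (\<tau> x) * (p * \<phi>)"
      using V\<phi> \<theta>r by (simp add: V_def algebra_simps)
    also have "\<dots> = (\<Sum>i=1..\<tau> x. c * (u (X i x) - p) - p * \<phi>)"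
      by (simp add: d_def c_def sum_subtractf sum_distrib_left[symmetric] algebra_simps)
    finally have "exp l \<le> exp (\<Sum>i=1..\<tau> x. c * (u (X i x) - p) - p * \<phi>)" by simp
    also have "\<dots> = ?Y x" by (simp add: \<tau>n[OF x] w_def exp_sum)
    finally show "exp l \<le> ?Y x" .
  qed
  moreover have "{x \<in> space M. exp l \<le> ?Y x} \<in> events"
    using borel_measurable_integrable[OF Y(1)] by measurable
  ultimately have "prob ?E \<le> prob {x \<in> space M. exp l \<le> ?Y x}"
    by (intro finite_measure_mono)
  also have "\<dots> \<le> expectation ?Y / exp l"
    by (rule integral_Markov_inequality_measure[OF Y(1), of "{}"]) (auto intro!: AE_I2 prod_nonneg w0)
  also have "\<dots> \<le> 1 / exp l" using Y(2) by (intro divide_right_mono) auto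
  finally show ?thesis by (simp add: exp_minus inverse_eq_divide)
qed

section \<open>Application to the betweenness estimate\<close>

theorem theorem6:
  fixes G :: "('a, 'b) pre_digraph" and v :: 'a
    and M :: "'w measure" and \<pi> :: "nat \<Rightarrow> 'w \<Rightarrow> 'b awalk" and \<tau> :: "'w \<Rightarrow> nat"
    and \<omega> \<delta>\<^sub>L \<delta>\<^sub>U :: real
  assumes "digraph G" and "2 \<le> card (verts G)" and "v \<in> verts G"
    and "prob_space M"
    and "prob_space.indep_vars M (\<lambda>_. count_space UNIV) \<pi> {1..}"
    and "\<And>i. 1 \<le> i \<Longrightarrow> distr M (count_space UNIV) (\<pi> i) = measure_pmf (random_path G)"
    and "0 < \<omega>"
    and "\<tau> \<in> measurable M (count_space UNIV)"
    and "\<And>x. x \<in> space M \<Longrightarrow> 0 < \<tau> x \<and> real (\<tau> x) \<le> \<omega>"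
    and "\<And>t. \<exists>D. \<forall>x \<in> space M. \<tau> x = t \<longleftrightarrow> map (\<lambda>i. \<pi> i x) [1..<Suc t] \<in> D"
    and "0 < \<delta>\<^sub>L" and "\<delta>\<^sub>L < 1" and "0 < \<delta>\<^sub>U" and "\<delta>\<^sub>U < 1"
  defines "est \<equiv> \<lambda>x. empirical_betweenness G v (\<lambda>i. \<pi> i x) (\<tau> x)"
  shows "(0 < betweenness G v \<longrightarrow>
           measure M {x \<in> space M. betweenness G v \<le> est x - lower_dev (est x) \<delta>\<^sub>L \<omega> (\<tau> x)} \<le> \<delta>\<^sub>L) \<and>
         measure M {x \<in> space M. betweenness G v \<ge> est x + upper_dev (est x) \<delta>\<^sub>U \<omega> (\<tau> x)} \<le> \<delta>\<^sub>U"
proof -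
  interpret G: digraph G by fact
  interpret M: prob_space M by fact
  define p where "p = betweenness G v"
  define Z where "Z x = (\<Sum>i=1..\<tau> x. hit G v (\<pi> i x))" for x
  define S where "S = set_pmf (random_path G)"
  have hit01: "hit G v q \<in> {0, 1}" for q by (simp add: hit_def)
  \<comment> \<open>A finite graph has finitely many node pairs and shortest paths; this supplies
    the finite support for the stopping argument.\<close>
  have fin: "finite S"
  proof -
    let ?P = "{(s, t). s \<in> verts G \<and> t \<in> verts G \<and> s \<noteq> t}"
    have fP: "finite ?P" by (rule finite_subset[of _ "verts G \<times> verts G"]) auto
    obtain s t where "s \<in> verts G" "t \<in> verts G" "s \<noteq> t"
      using assms(2) card_le_Suc0_iff_eq[OF G.finite_verts] by fastforce
    then have "?P \<noteq> {}" by blast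
    then show ?thesis unfolding S_def random_path_def
      using fP by (auto simp: set_pmf_of_set G.finite_shortest_paths)
  qed
  have \<pi>: "\<pi> i \<in> measurable M (count_space UNIV)" if "1 \<le> i" for i
    using assms(5) that by (auto simp: M.indep_vars_def)
  have supp: "AE x in M. \<pi> i x \<in> S" if i: "1 \<le> i" for i
  proof -
    have "AE q in distr M (count_space UNIV) (\<pi> i). q \<in> S"
      unfolding assms(6)[OF i] S_def by (rule AE_measure_pmf)
    then show ?thesis by (subst (asm) AE_distr_iff) (use \<pi>[OF i] in auto)
  qed
  have mean: "M.expectation (\<lambda>x. hit G v (\<pi> i x)) = p" if i: "1 \<le> i" for i
    using G.expectation_hit[OF assms(2), of v] integral_distr[OF \<pi>[OF i], of "hit G v"]
    by (simp add: assms(6)[OF i] p_def)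
  have p0: "0 \<le> p"
    unfolding mean[of 1, OF order_refl, symmetric] by (rule integral_nonneg_AE) (simp add: hit_def)
  have est: "est x = Z x / real (\<tau> x)" for x
    by (simp add: est_def empirical_betweenness_def Z_def)
  have Z0: "0 \<le> Z x" for x unfolding Z_def by (intro sum_nonneg) (simp add: hit_def)
  have est0: "0 \<le> est x" for x using Z0 by (simp add: est)
  have k_est: "real (\<tau> x) * est x = Z x" if "x \<in> space M" for x
    using assms(9)[OF that] by (simp add: est)
  define d where "d e x = e * (Z x - real (\<tau> x) * p)" for e x
  define E where "E l e = {x \<in> space M. 0 \<le> d e x \<and> 2 * l * (\<omega> * p + d e x / 3) \<le> (d e x)\<^sup>2}" for l e
  \<comment> \<open>Both tail events will be embedded in the measurable event \<open>E\<close>, with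
    e = 1 for overestimation and e = -1 for underestimation.\<close>
  have tail: "M.prob A \<le> \<delta>" if "A \<subseteq> E (ln (1 / \<delta>)) e" "0 < p" "\<bar>e\<bar> = 1" "0 < \<delta>" "\<delta> < 1" for A \<delta> e
  proof -
    note hitm = measurable_compose[OF \<pi>, of _ "hit G v" borel]
    have [measurable]: "Z \<in> borel_measurable M" unfolding Z_def
      by (rule measurable_compose_countable[where g=\<tau> and f="\<lambda>t x. \<Sum>i=1..t. hit G v (\<pi> i x)"])
         (use assms(8) hitm in \<open>auto intro!: borel_measurable_sum\<close>)
    note [measurable] = assms(8)
    have "E (ln (1 / \<delta>)) e \<in> sets M" unfolding E_def d_def by measurable
    then have "M.prob A \<le> M.prob (E (ln (1 / \<delta>)) e)" by (intro M.finite_measure_mono that)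
    also have "\<dots> \<le> exp (- ln (1 / \<delta>))"
      unfolding E_def d_def Z_def
      by (rule M.stopped_bernstein[OF assms(5) fin supp hit01 mean assms(8) _ assms(10)])
         (use assms(7,9) that in auto)
    also have "\<dots> = \<delta>" using that by (simp add: ln_div)
    finally show ?thesis .
  qed
  have sub: "x \<in> E (ln (1 / \<delta>)) e"
    if x: "x \<in> space M" and \<delta>: "0 < \<delta>" "\<delta> < 1" and e: "e * e = 1"
      and le: "1 / real (\<tau> x) * ln (1 / \<delta>) * (1 / 3 - e * \<omega> / real (\<tau> x) +
        sqrt ((1 / 3 - e * \<omega> / real (\<tau> x))\<^sup>2 + 2 * est x * \<omega> / ln (1 / \<delta>))) \<le> e * (est x - p)"
    for x \<delta> e
    using deviation_quadratic[OF _ _ _ est0 e le] assms(7) assms(9)[OF x] \<delta> x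
    by (simp add: E_def d_def k_est)
  have lower: "M.prob {x \<in> space M. p \<le> est x - lower_dev (est x) \<delta>\<^sub>L \<omega> (\<tau> x)} \<le> \<delta>\<^sub>L"
    if "0 < p"
    by (rule tail[of _ _ 1]) (use that assms(11,12) in \<open>auto intro!: sub simp: lower_dev_def\<close>)
  have upper: "M.prob {x \<in> space M. p \<ge> est x + upper_dev (est x) \<delta>\<^sub>U \<omega> (\<tau> x)} \<le> \<delta>\<^sub>U" (is "M.prob ?U \<le> _")
  \<comment> \<open>The exponential bound is stated for positive p. At p = 0 the event is empty,
    because the estimate is nonnegative and \<open>upper_dev\<close> is strictly positive.\<close>
  proof (cases "p = 0")
    case True
    have pos: "0 < upper_dev (est x) \<delta>\<^sub>U \<omega> (\<tau> x)" if x: "x \<in> space M" for x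
      unfolding upper_dev_def using assms(7,13,14) assms(9)[OF x] est0[of x]
      by (intro mult_pos_pos add_pos_nonneg) auto
    have "?U = {}" using pos est0 True by (force simp: not_le intro: add_nonneg_pos)
    then show ?thesis using assms(13) by (simp only: measure_empty less_imp_le)
  next
    case False
    show ?thesis
      by (rule tail[of _ _ "-1"]) (use False p0 assms(13,14) in \<open>auto intro!: sub simp: upper_dev_def\<close>)
  qed
  show ?thesis using lower upper unfolding p_def by blast
qed

end
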